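(* Let $L$ and $M$ be bounded lattices with $|L|>2$ and $|M|>2$, and let $A=L\boxplus M$ be their horizontal sum. Then $A$ has nontrivial weak complementations iff $1$ is strictly join-irreducible in each of the lattices $L$ and $M$. In this case $A$ has exactly two weak complementations, both of which are representable: the trivial weak complementation $\cdot^{\Delta A}$ and the nontrivial weak complementation $\cdot^{\Delta 1^{-L},1^{-M}}$, where $\cdot^{\Delta 1^{-L},1^{-M}}$ equals the weak complementation $\cdot^{\Delta J}$ associated to the join-dense subset $J=(1^{-L}]_A\cup(1^{-M}]_A$ of $A$, and $\cdot^{\Delta 1^{-L},1^{-M}}<\cdot^{\Delta A}$ in the pointwise order. If moreover $A$ is complete and dually algebraic, then $\cdot^{\Delta 1^{-L},1^{-M}}=\cdot^{\Delta \mathrm{Sji}(A)}$.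
   Context: A weak complementation on a bounded lattice $(A,\wedge,\vee,0,1)$ is an order-reversing unary operation $\cdot^{\Delta}$ with $x^{\Delta\Delta}\leq x$ and $(x\wedge y)\vee(x\wedge y^{\Delta})=x$ for all $x,y\in A$. The trivial weak complementation $\cdot^{\Delta A}$ sends $1$ to $0$ and every other element to $1$. The horizontal sum $L\boxplus M$ of nontrivial bounded lattices is obtained by identifying the bottoms of $L$ and $M$ and identifying their tops, every element of $L\setminus\{0,1\}$ being incomparable to every element of $M\setminus\{0,1\}$; $L,M$ are regarded as bounded sublattices of it. $(a]_A=\{x\in A: x\leq a\}$. An element $b$ of a lattice $K$ is strictly join-irreducible if the set $\{x\in K: x<b\}$ has a greatest element, which is then the unique predecessor of $b$ in $K$, denoted $b^{-K}$; thus $1^{-L}$ and $1^{-M}$ are the greatest elements of $L\setminus\{1\}$ and $M\setminus\{1\}$. $\mathrm{Sji}(A)$ is the set of strictly join-irreducible elements of $A$. For distinct $a,b\in A\setminus\{0,1\}$, $\cdot^{\Delta a,b}$ is the unary operation with $1^{\Delta a,b}=0$, $a^{\Delta a,b}=b$, $b^{\Delta a,b}=a$ and $x^{\Delta a,b}=1$ for $x\notin\{1,a,b\}$. $J\subseteq A$ is join-dense if every element of $A$ is the join of a subset of $J$. For a join-dense $J$, $x^{\Delta J}=\bigvee(J\setminus (x]_A)$ for all $x\in A$ (when these joins exist), and a weak complementation is representable if it equals $\cdot^{\Delta J}$ for some join-dense $J$. A complete lattice is dually algebraic if its dual is an algebraic lattice. *)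

theory Defs
  imports "HOL-Library.Lub_Glb" "HOL-Library.Dual_Ordered_Lattice"
begin

section \<open>Horizontal sums\<close>

class nontrivial_bounded_lattice = bounded_lattice +
  assumes bot_noteq_top: "bot \<noteq> top"
begin

lemma top_noteq_bot: "top \<noteq> bot"
  using bot_noteq_top by simp

end

text \<open>The disjoint union of the two lattices with bottom glued to bottom and top glued to top.
  For this to be an equivalence relation, both lattices have to be nontrivial.\<close>

fun hsum_eq :: "'a::nontrivial_bounded_lattice + 'b::nontrivial_bounded_lattice \<Rightarrow> 'a + 'b \<Rightarrow> bool" where
  "hsum_eq (Inl x) (Inl x') \<longleftrightarrow> x = x'"
| "hsum_eq (Inr y) (Inr y') \<longleftrightarrow> y = y'"
| "hsum_eq (Inl x) (Inr y) \<longleftrightarrow> x = bot \<and> y = bot \<or> x = top \<and> y = top"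
| "hsum_eq (Inr y) (Inl x) \<longleftrightarrow> x = bot \<and> y = bot \<or> x = top \<and> y = top"

quotient_type (overloaded) ('a, 'b) hsum =
  "'a::nontrivial_bounded_lattice + 'b::nontrivial_bounded_lattice" / hsum_eq
proof (rule equivpI)
  show "reflp (hsum_eq :: 'a + 'b \<Rightarrow> _)"
  proof (rule reflpI)
    fix u :: "'a + 'b"
    show "hsum_eq u u" by (cases u) auto
  qed
  show "symp (hsum_eq :: 'a + 'b \<Rightarrow> _)"
  proof (rule sympI)
    fix u v :: "'a + 'b"
    assume "hsum_eq u v"
    then show "hsum_eq v u" by (cases u; cases v) auto
  qed
  show "transp (hsum_eq :: 'a + 'b \<Rightarrow> _)"
  proof (rule transpI)
    fix u v w :: "'a + 'b"
    assume "hsum_eq u v" "hsum_eq v w"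
    then show "hsum_eq u w"
      by (cases u; cases v; cases w) (auto simp: bot_noteq_top top_noteq_bot)
  qed
qed

lift_definition hleft :: "'a::nontrivial_bounded_lattice \<Rightarrow> ('a, 'b::nontrivial_bounded_lattice) hsum"
  is Inl .

lift_definition hright :: "'b::nontrivial_bounded_lattice \<Rightarrow> ('a::nontrivial_bounded_lattice, 'b) hsum"
  is Inr .

fun hsum_le :: "'a::nontrivial_bounded_lattice + 'b::nontrivial_bounded_lattice \<Rightarrow> 'a + 'b \<Rightarrow> bool" where
  "hsum_le (Inl x) (Inl x') \<longleftrightarrow> x \<le> x'"
| "hsum_le (Inr y) (Inr y') \<longleftrightarrow> y \<le> y'"
| "hsum_le (Inl x) (Inr y) \<longleftrightarrow> x = bot \<or> y = top"
| "hsum_le (Inr y) (Inl x) \<longleftrightarrow> y = bot \<or> x = top"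

fun hsum_inf :: "'a::nontrivial_bounded_lattice + 'b::nontrivial_bounded_lattice \<Rightarrow> 'a + 'b \<Rightarrow> 'a + 'b" where
  "hsum_inf (Inl x) (Inl x') = Inl (inf x x')"
| "hsum_inf (Inr y) (Inr y') = Inr (inf y y')"
| "hsum_inf (Inl x) (Inr y) = (if x = top then Inr y else if y = top then Inl x else Inl bot)"
| "hsum_inf (Inr y) (Inl x) = (if x = top then Inr y else if y = top then Inl x else Inl bot)"

fun hsum_sup :: "'a::nontrivial_bounded_lattice + 'b::nontrivial_bounded_lattice \<Rightarrow> 'a + 'b \<Rightarrow> 'a + 'b" where
  "hsum_sup (Inl x) (Inl x') = Inl (sup x x')"
| "hsum_sup (Inr y) (Inr y') = Inr (sup y y')"
| "hsum_sup (Inl x) (Inr y) = (if x = bot then Inr y else if y = bot then Inl x else Inl top)"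
| "hsum_sup (Inr y) (Inl x) = (if x = bot then Inr y else if y = bot then Inl x else Inl top)"

instantiation hsum :: (nontrivial_bounded_lattice, nontrivial_bounded_lattice) nontrivial_bounded_lattice
begin

lift_definition less_eq_hsum :: "('a, 'b) hsum \<Rightarrow> ('a, 'b) hsum \<Rightarrow> bool" is hsum_le
  subgoal for u u' v v'
    by (cases u; cases u'; cases v; cases v')
      (auto simp: bot_noteq_top top_noteq_bot bot_unique top_unique)
  done

definition less_hsum :: "('a, 'b) hsum \<Rightarrow> ('a, 'b) hsum \<Rightarrow> bool" where
  "less_hsum u v \<longleftrightarrow> u \<le> v \<and> \<not> v \<le> u"

lift_definition inf_hsum :: "('a, 'b) hsum \<Rightarrow> ('a, 'b) hsum \<Rightarrow> ('a, 'b) hsum" is hsum_inf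
  subgoal for u u' v v'
    by (cases u; cases u'; cases v; cases v')
      (auto simp: bot_noteq_top top_noteq_bot)
  done

lift_definition sup_hsum :: "('a, 'b) hsum \<Rightarrow> ('a, 'b) hsum \<Rightarrow> ('a, 'b) hsum" is hsum_sup
  subgoal for u u' v v'
    by (cases u; cases u'; cases v; cases v')
      (auto simp: bot_noteq_top top_noteq_bot)
  done

lift_definition bot_hsum :: "('a, 'b) hsum" is "Inl bot" .

lift_definition top_hsum :: "('a, 'b) hsum" is "Inl top" .

instance
proof
  fix u v w :: "('a, 'b) hsum"
  show "u < v \<longleftrightarrow> u \<le> v \<and> \<not> v \<le> u"
    by (fact less_hsum_def)
  show "u \<le> u"
    by transfer (case_tac u; simp)
  show "u \<le> v \<Longrightarrow> v \<le> w \<Longrightarrow> u \<le> w"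
    by transfer (case_tac u; case_tac v; case_tac w; auto simp: bot_unique top_unique bot_noteq_top top_noteq_bot)
  show "u \<le> v \<Longrightarrow> v \<le> u \<Longrightarrow> u = v"
    by transfer (case_tac u; case_tac v; auto simp: bot_noteq_top top_noteq_bot)
  show "inf u v \<le> u"
    by transfer (case_tac u; case_tac v; auto)
  show "inf u v \<le> v"
    by transfer (case_tac u; case_tac v; auto)
  show "u \<le> v \<Longrightarrow> u \<le> w \<Longrightarrow> u \<le> inf v w"
    by transfer (case_tac u; case_tac v; case_tac w; auto simp: bot_unique top_unique)
  show "u \<le> sup u v"
    by transfer (case_tac u; case_tac v; auto)
  show "v \<le> sup u v"
    by transfer (case_tac u; case_tac v; auto)
  show "v \<le> u \<Longrightarrow> w \<le> u \<Longrightarrow> sup v w \<le> u"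
    by transfer (case_tac u; case_tac v; case_tac w; auto simp: bot_unique top_unique)
  show "bot \<le> u"
    by transfer (rename_tac u, case_tac u, auto)
  show "u \<le> top"
    by transfer (rename_tac u, case_tac u, auto)
  show "(bot :: ('a, 'b) hsum) \<noteq> top"
    by transfer (auto simp: bot_noteq_top)
qed

end

text \<open>Both summands are bounded sublattices of the sum, which they cover; they share exactly the
  bounds, and their remaining elements are pairwise incomparable.\<close>

lemma hleft_embedding:
  "hleft bot = bot" "hleft top = top" "hleft x = hleft x' \<longleftrightarrow> x = x'"
  "hleft x \<le> hleft x' \<longleftrightarrow> x \<le> x'"
  "hleft (inf x x') = inf (hleft x) (hleft x')" "hleft (sup x x') = sup (hleft x) (hleft x')"
  by (transfer; simp)+

lemma hright_embedding:
  "hright bot = bot" "hright top = top" "hright y = hright y' \<longleftrightarrow> y = y'"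
  "hright y \<le> hright y' \<longleftrightarrow> y \<le> y'"
  "hright (inf y y') = inf (hright y) (hright y')" "hright (sup y y') = sup (hright y) (hright y')"
  by (transfer; simp)+

lemma hsum_cover: "range hleft \<union> range hright = UNIV"
proof -
  have "u \<in> range hleft \<union> range hright" for u :: "('a, 'b) hsum"
  proof -
    have "(\<exists>x. u = hleft x) \<or> (\<exists>y. u = hright y)"
    proof (transfer)
      fix u :: "'a + 'b"
      show "(\<exists>x. hsum_eq u (Inl x)) \<or> (\<exists>y. hsum_eq u (Inr y))"
        by (cases u) auto
    qed
    then show ?thesis by auto
  qed
  then show ?thesis by auto
qed

lemma hleft_eq_hright_iff: "hleft x = hright y \<longleftrightarrow> x = bot \<and> y = bot \<or> x = top \<and> y = top"
  by transfer simp

lemma hleft_le_hright_iff: "hleft x \<le> hright y \<longleftrightarrow> x = bot \<or> y = top"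
  by transfer simp

lemma hright_le_hleft_iff: "hright y \<le> hleft x \<longleftrightarrow> y = bot \<or> x = top"
  by transfer simp


section \<open>Weak complementations\<close>

definition weak_complementation :: "('a::bounded_lattice \<Rightarrow> 'a) \<Rightarrow> bool" where
  "weak_complementation f \<longleftrightarrow>
     antimono f \<and> (\<forall>x. f (f x) \<le> x) \<and> (\<forall>x y. sup (inf x y) (inf x (f y)) = x)"

definition trivial_wc :: "'a::bounded_lattice \<Rightarrow> 'a" where
  "trivial_wc x = (if x = top then bot else top)"

text \<open>Only meant for distinct \<open>a\<close> and \<open>b\<close> different from the bounds.\<close>

definition swap_wc :: "'a::bounded_lattice \<Rightarrow> 'a \<Rightarrow> 'a \<Rightarrow> 'a" where
  "swap_wc a b x = (if x = top then bot else if x = a then b else if x = b then a else top)"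


section \<open>Strict join-irreducibility, join-density, representability\<close>

definition strictly_join_irreducible :: "'a::lattice \<Rightarrow> bool" where
  "strictly_join_irreducible b \<longleftrightarrow> (\<exists>m. m < b \<and> (\<forall>x. x < b \<longrightarrow> x \<le> m))"

text \<open>Only meant for strictly join-irreducible \<open>b\<close>.\<close>

definition predecessor :: "'a::lattice \<Rightarrow> 'a" where
  "predecessor b = (GREATEST x. x < b)"

definition Sji :: "'a::lattice set" where
  "Sji = {b. strictly_join_irreducible b}"

definition join_dense :: "'a::lattice set \<Rightarrow> bool" where
  "join_dense J \<longleftrightarrow> (\<forall>x. \<exists>S\<subseteq>J. isLub UNIV S x)"

text \<open>\<open>represented_by f J\<close> says that \<open>J\<close> is join-dense, that all the joins of the sets
  \<open>J - {..x}\<close> exist, and that \<open>f\<close> maps each \<open>x\<close> to this join.\<close>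

definition represented_by :: "('a::bounded_lattice \<Rightarrow> 'a) \<Rightarrow> 'a set \<Rightarrow> bool" where
  "represented_by f J \<longleftrightarrow> join_dense J \<and> (\<forall>x. isLub UNIV (J - {..x}) (f x))"

definition representable :: "('a::bounded_lattice \<Rightarrow> 'a) \<Rightarrow> bool" where
  "representable f \<longleftrightarrow> (\<exists>J. represented_by f J)"


section \<open>Complete and dually algebraic lattices\<close>

text \<open>Completeness as a property of a bounded lattice type: there are infinitary operations
  turning it into an instance of \<^class>\<open>complete_lattice\<close>.\<close>

definition is_complete :: "'a::bounded_lattice itself \<Rightarrow> bool" where
  "is_complete _ \<longleftrightarrow>
     (\<exists>Inf Sup. class.complete_lattice Inf Sup inf (\<le>) (<) sup (bot :: 'a) top)"

definition compact_element :: "'a::bounded_lattice \<Rightarrow> bool" where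
  "compact_element c \<longleftrightarrow>
     (\<forall>S s. isLub UNIV S s \<and> c \<le> s \<longrightarrow>
        (\<exists>F t. F \<subseteq> S \<and> finite F \<and> isLub UNIV F t \<and> c \<le> t))"

definition algebraic :: "'a::bounded_lattice itself \<Rightarrow> bool" where
  "algebraic T \<longleftrightarrow>
     is_complete T \<and> (\<forall>x::'a. \<exists>C. (\<forall>c\<in>C. compact_element c) \<and> isLub UNIV C x)"

definition dually_algebraic :: "'a::bounded_lattice itself \<Rightarrow> bool" where
  "dually_algebraic _ \<longleftrightarrow> algebraic TYPE('a dual)"

end

theory Submission
  imports Defs
begin

text \<open>Call the elements of a horizontal sum other than \<open>bot\<close> and \<open>top\<close> proper. The only fact about
  the sum that matters is that its proper elements fall into two nonempty parts \<open>P\<close> and \<open>Q\<close>, two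
  elements of different parts having meet \<open>bot\<close> and join \<open>top\<close>; the locale \<open>horizontal_split\<close>
  records this, and its symmetry in \<open>P\<close> and \<open>Q\<close> halves all arguments.

  A weak complementation \<open>f\<close> always exchanges \<open>bot\<close> and \<open>top\<close>. If it is not trivial, then
  \<open>f x \<noteq> top\<close> for some proper \<open>x\<close>, say in \<open>P\<close>. The law
  \<open>(y \<sqinter> x) \<squnion> (y \<sqinter> f x) = y\<close> then does everything: applied to \<open>y \<in> Q\<close> it
  excludes \<open>f x \<in> P\<close>, as both meets would be \<open>bot\<close>; so \<open>f x \<in> Q\<close>, and the law makes \<open>x\<close> the greatest
  element of \<open>P\<close> and \<open>f x\<close> the greatest element of \<open>Q\<close> (\<open>nontrivial_value\<close>). Hence both parts have
  greatest elements \<open>a\<close> and \<open>b\<close>, and \<open>f\<close>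
  can only exchange them and agree with the trivial weak complementation elsewhere
  (\<open>nontrivial_imp_swap\<close>).

  That exchanging them is indeed a weak complementation need not be computed: every represented
  operation is one (\<open>represented_by_imp_weak_complementation\<close>), and the exchange is represented by
  any join-dense set that avoids \<open>top\<close> (\<open>swap_represented_by\<close>). The set of all elements below \<open>a\<close> or
  \<open>b\<close> is such a set. So is \<^term>\<open>Sji\<close> if the lattice is dually algebraic: \<open>top\<close> has no unique
  predecessor because it is the join of two proper elements, and join-density is the
  dual of Birkhoff's theorem that the completely meet-irreducible elements of an algebraic lattice
  are meet-dense (\<open>algebraic_separation\<close>).\<close>

section \<open>Least upper bounds and join-density\<close>

lemma isLub_UNIV_iff: "isLub UNIV S x \<longleftrightarrow> (\<forall>u::'a::order. x \<le> u \<longleftrightarrow> (\<forall>s\<in>S. s \<le> u))"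
  unfolding isLub_def leastP_def isUb_def setle_def setge_def
  by (auto intro: order_trans)

text \<open>The second form is the one that allows contradictions: an element that does not lie below
  \<open>u\<close> is separated from \<open>u\<close> by a member of the join-dense set.\<close>

lemma join_dense_iff_separating:
  fixes J :: "'a::lattice set"
  shows "join_dense J \<longleftrightarrow> (\<forall>x u. \<not> x \<le> u \<longrightarrow> (\<exists>j\<in>J. j \<le> x \<and> \<not> j \<le> u))" (is "?l \<longleftrightarrow> ?r")
proof
  assume ?l
  show ?r
  proof (intro allI impI)
    fix x u :: 'a
    assume "\<not> x \<le> u"
    obtain S where "S \<subseteq> J" and S: "isLub UNIV S x"
      using \<open>?l\<close> unfolding join_dense_def by blast
    have "\<forall>s\<in>S. s \<le> x"
      using S unfolding isLub_UNIV_iff by blast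
    moreover obtain s where "s \<in> S" "\<not> s \<le> u"
      using S \<open>\<not> x \<le> u\<close> unfolding isLub_UNIV_iff by blast
    ultimately show "\<exists>j\<in>J. j \<le> x \<and> \<not> j \<le> u"
      using \<open>S \<subseteq> J\<close> by blast
  qed
next
  assume r: ?r
  have "isLub UNIV (J \<inter> {..x}) x" for x
    unfolding isLub_UNIV_iff using r by (meson IntD2 IntI atMost_iff order_trans)
  then show ?l
    unfolding join_dense_def by (meson inf_le1)
qed

lemma predecessor_greatest:
  assumes "strictly_join_irreducible b"
  shows "predecessor b < b" and "x < b \<Longrightarrow> x \<le> predecessor b"
proof -
  obtain m where m: "m < b" "\<And>x. x < b \<Longrightarrow> x \<le> m"
    using assms unfolding strictly_join_irreducible_def by blast
  have "predecessor b = m"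
    unfolding predecessor_def by (rule Greatest_equality) (use m in auto)
  then show "predecessor b < b" "x < b \<Longrightarrow> x \<le> predecessor b"
    using m by auto
qed

section \<open>Weak complementations in arbitrary bounded lattices\<close>

lemma
  assumes "weak_complementation f"
  shows weak_complementation_split: "sup (inf x y) (inf x (f y)) = x"
    and weak_complementation_sup: "sup y (f y) = top"
    and weak_complementation_bot: "f bot = top"
    and weak_complementation_top: "f top = bot"
proof -
  show split: "sup (inf x y) (inf x (f y)) = x" for x y
    using assms unfolding weak_complementation_def by blast
  show *: "sup y (f y) = top" for y
    using split[of top y] by simp
  show bot: "f bot = top"
    using *[of bot] by simp
  have "f (f bot) \<le> bot"
    using assms unfolding weak_complementation_def by blast
  then show "f top = bot"
    by (simp add: bot bot_unique)
qed

text \<open>Everything follows from the observation that each \<open>j \<in> J\<close> lies below \<open>x\<close> or below \<open>f x\<close>: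
  \<open>f x\<close> is the join of precisely those \<open>j\<close> that do not lie below \<open>x\<close>.\<close>

lemma represented_by_imp_weak_complementation:
  fixes f :: "'a::bounded_lattice \<Rightarrow> 'a"
  assumes "represented_by f J"
  shows "weak_complementation f"
proof -
  have dense: "\<And>x u. \<not> x \<le> u \<Longrightarrow> \<exists>j\<in>J. j \<le> x \<and> \<not> j \<le> u"
    and lub: "\<And>x u. f x \<le> u \<longleftrightarrow> (\<forall>j\<in>J - {..x}. j \<le> u)"
    using assms
    unfolding represented_by_def join_dense_iff_separating isLub_UNIV_iff by blast+
  have below: "j \<le> x \<or> j \<le> f x" if "j \<in> J" for j x
    using that lub[of x "f x"] by auto
  have "antimono f"
    by (rule antimonoI) (use lub below in \<open>auto intro: order_trans\<close>)
  moreover have "f (f x) \<le> x" for x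
    using lub below by auto
  moreover have "sup (inf x y) (inf x (f y)) = x" for x y
  proof (rule antisym)
    show "x \<le> sup (inf x y) (inf x (f y))"
    proof (rule ccontr)
      assume "\<not> x \<le> sup (inf x y) (inf x (f y))"
      then obtain j where "j \<in> J" "j \<le> x" and j: "\<not> j \<le> sup (inf x y) (inf x (f y))"
        using dense by blast
      then have "j \<le> inf x y \<or> j \<le> inf x (f y)"
        using below by auto
      with j show False
        by (auto intro: le_supI1 le_supI2)
    qed
  qed simp
  ultimately show ?thesis
    unfolding weak_complementation_def by blast
qed

lemma trivial_wc_represented_by: "represented_by (trivial_wc :: 'a::bounded_lattice \<Rightarrow> 'a) UNIV"
  unfolding represented_by_def join_dense_iff_separating isLub_UNIV_iff trivial_wc_def
  by (auto simp: top_unique dest: bspec[where x = top])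

section \<open>Birkhoff's theorem for algebraic lattices\<close>

text \<open>Some compact \<open>c \<le> x\<close> already fails to lie below \<open>u\<close>. By compactness, the elements above \<open>u\<close> but
  not above \<open>c\<close> are closed under joins of chains, so there is a maximal one, \<open>m\<close>. Everything
  strictly above \<open>m\<close> is then above \<open>c\<close>, hence above \<^term>\<open>sup m c\<close>, the unique successor of \<open>m\<close>.\<close>

lemma algebraic_separation:
  fixes u x :: "'a::bounded_lattice"
  assumes "algebraic TYPE('a)" and "\<not> x \<le> u"
  shows "\<exists>m\<ge>u. \<not> x \<le> m \<and> (\<exists>s>m. \<forall>z>m. s \<le> z)"
proof -
  obtain C where compact: "\<And>c. c \<in> C \<Longrightarrow> compact_element c" and C: "isLub UNIV C x"
    using assms(1) unfolding algebraic_def by blast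
  obtain c where c: "compact_element c" "c \<le> x" "\<not> c \<le> u"
    using C compact assms(2) unfolding isLub_UNIV_iff by blast
  obtain Inf Sup where "class.complete_lattice Inf Sup inf (\<le>) (<) sup (bot :: 'a) top"
    using assms(1) unfolding algebraic_def is_complete_def by blast
  then interpret cl: complete_lattice Inf Sup inf "(\<le>)" "(<)" sup "bot :: 'a" top .
  define Z where "Z = {z. u \<le> z \<and> \<not> c \<le> z}"
  have po: "partial_order_on Z (relation_of (\<le>) Z)"
    by (rule partial_order_on_relation_ofI) auto
  have "\<exists>v\<in>Z. \<forall>z\<in>K. z \<le> v" if "K \<in> Chains (relation_of (\<le>) Z)" for K
  proof (cases "K = {}")
    case True
    with c show ?thesis unfolding Z_def by auto
  next
    case False
    have "K \<subseteq> Z" and chain: "\<And>y z. y \<in> K \<Longrightarrow> z \<in> K \<Longrightarrow> y \<le> z \<or> z \<le> y"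
      using that unfolding Chains_def relation_of_def by auto
    have lub: "isLub UNIV K (Sup K)"
      unfolding isLub_UNIV_iff by (simp add: cl.Sup_le_iff)
    have upper: "z \<le> Sup K" if "z \<in> K" for z
      using that by (rule cl.Sup_upper)
    have "\<not> c \<le> Sup K"
    proof
      assume "c \<le> Sup K"
      then have "\<exists>F t. F \<subseteq> K \<and> finite F \<and> isLub UNIV F t \<and> c \<le> t"
        using c(1)[unfolded compact_element_def, rule_format, OF conjI, OF lub] by simp
      then obtain F t where F: "F \<subseteq> K" "finite F" and t: "isLub UNIV F t" and "c \<le> t"
        by blast
      obtain k where "k \<in> K"
        using False by blast
      \<comment> \<open>The element \<open>k\<close> covers the case of an empty \<open>F\<close>.\<close>
      have "\<exists>z\<in>K. \<forall>y\<in>F. y \<le> z"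
        using F(2,1)
      proof (induction F)
        case empty
        then show ?case using \<open>k \<in> K\<close> by blast
      next
        case (insert y F)
        then obtain z where z: "z \<in> K" "\<forall>y\<in>F. y \<le> z" by auto
        with insert.prems chain[of y z] show ?case
          by (auto intro: order_trans)
      qed
      then obtain z where "z \<in> K" "t \<le> z"
        using t unfolding isLub_UNIV_iff by blast
      with \<open>c \<le> t\<close> \<open>K \<subseteq> Z\<close> show False
        unfolding Z_def by (auto intro: order_trans)
    qed
    moreover have "u \<le> Sup K"
      using False \<open>K \<subseteq> Z\<close> upper unfolding Z_def by (auto intro: order_trans)
    ultimately show ?thesis
      using upper unfolding Z_def by blast
  qed
  then obtain m where m: "m \<in> Z" "\<forall>z\<in>Z. m \<le> z \<longrightarrow> z = m"
    using predicate_Zorn[OF po] by auto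
  have "sup m c > m"
    using m(1) unfolding Z_def by (metis mem_Collect_eq order_neq_le_trans sup_ge1 sup_ge2)
  moreover have "sup m c \<le> z" if "z > m" for z
  proof -
    have "z \<notin> Z"
      using m(2) that by auto
    then have "c \<le> z"
      using m(1) that unfolding Z_def by (auto intro: order_trans)
    then show ?thesis
      using that by simp
  qed
  moreover have "\<not> x \<le> m"
    using m(1) c(2) unfolding Z_def by (auto intro: order_trans)
  ultimately show ?thesis
    using m(1) unfolding Z_def by blast
qed

lemma dually_algebraic_Sji_join_dense:
  assumes "dually_algebraic TYPE('a::bounded_lattice)"
  shows "join_dense (Sji :: 'a set)"
  unfolding join_dense_iff_separating
proof (intro allI impI)
  fix x u :: 'a
  assume "\<not> x \<le> u"
  then have "\<not> dual u \<le> dual x"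
    by simp
  then obtain m s where "dual x \<le> m" "\<not> dual u \<le> m" "s > m" and succ: "\<forall>z>m. s \<le> z"
    using algebraic_separation assms unfolding dually_algebraic_def by blast
  moreover have "z \<le> undual s" if "z < undual m" for z
  proof -
    have "m < dual z"
      using that by (simp add: less_dual_def)
    then have "s \<le> dual z"
      using succ by blast
    then show ?thesis
      by (simp add: less_eq_dual_def)
  qed
  ultimately have "undual m \<in> Sji" "undual m \<le> x" "\<not> undual m \<le> u"
    unfolding Sji_def strictly_join_irreducible_def
    by (auto simp: less_eq_dual_def less_dual_def)
  then show "\<exists>j\<in>Sji. j \<le> x \<and> \<not> j \<le> u"
    by blast
qed

section \<open>Lattices split into two mutually complementary parts\<close>

definition greatest_in :: "'a::order set \<Rightarrow> 'a \<Rightarrow> bool" where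
  "greatest_in P a \<longleftrightarrow> a \<in> P \<and> (\<forall>x\<in>P. x \<le> a)"

lemma greatest_in_unique: "greatest_in P a \<Longrightarrow> greatest_in P a' \<Longrightarrow> a = a'"
  unfolding greatest_in_def by (blast intro: antisym)

locale horizontal_split =
  fixes P Q :: "'a::bounded_lattice set"
  assumes proper: "P \<union> Q = - {bot, top}"
    and nonempty: "P \<noteq> {}" "Q \<noteq> {}"
    and inf_across: "x \<in> P \<Longrightarrow> y \<in> Q \<Longrightarrow> inf x y = bot"
    and sup_across: "x \<in> P \<Longrightarrow> y \<in> Q \<Longrightarrow> sup x y = top"
begin

lemma flip: "horizontal_split Q P"
proof
  show "Q \<union> P = - {bot, top}" "Q \<noteq> {}" "P \<noteq> {}"
    using proper nonempty by auto
  show "inf x y = bot" "sup x y = top" if "x \<in> Q" "y \<in> P" for x y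
    using inf_across[OF that(2,1)] sup_across[OF that(2,1)]
    by (simp_all add: inf_commute sup_commute)
qed

lemma proper_cases: "x = bot \<or> x = top \<or> x \<in> P \<or> x \<in> Q"
  using proper by auto

lemma not_bounds: "x \<in> P \<Longrightarrow> x \<noteq> bot" "x \<in> P \<Longrightarrow> x \<noteq> top"
    "x \<in> Q \<Longrightarrow> x \<noteq> bot" "x \<in> Q \<Longrightarrow> x \<noteq> top"
  using proper by auto

lemma incomparable: "x \<in> P \<Longrightarrow> y \<in> Q \<Longrightarrow> \<not> x \<le> y \<and> \<not> y \<le> x"
  using inf_across[of x y] not_bounds by (auto simp: inf.absorb1 inf.absorb2)

lemma left_of_le: "x \<le> p \<Longrightarrow> p \<in> P \<Longrightarrow> x \<noteq> bot \<Longrightarrow> x \<in> P"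
  using proper_cases[of x] incomparable not_bounds by (auto simp: top_unique)

lemma nontrivial_value:
  assumes f: "weak_complementation f" and x: "x \<in> P" and "f x \<noteq> top"
  shows "greatest_in P x" and "greatest_in Q (f x)"
proof -
  note split = weak_complementation_split[OF f]
  have "f x \<noteq> bot"
    using weak_complementation_sup[OF f, of x] not_bounds(2)[OF x] by auto
  moreover have "f x \<notin> P"
  proof
    assume "f x \<in> P"
    obtain q where q: "q \<in> Q"
      using nonempty by blast
    have "q = bot"
      using split[of q x] inf_across[OF x q] inf_across[OF \<open>f x \<in> P\<close> q]
      by (simp add: inf_commute)
    then show False
      using not_bounds q by blast
  qed
  ultimately have fx: "f x \<in> Q"
    using proper_cases \<open>f x \<noteq> top\<close> by blast
  have "p \<le> x" if "p \<in> P" for p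
    using split[of p x] inf_across[OF that fx] by (simp add: inf.absorb_iff1)
  then show "greatest_in P x"
    using x unfolding greatest_in_def by blast
  have "q \<le> f x" if "q \<in> Q" for q
    using split[of q x] inf_across[OF x that] by (simp add: inf.absorb_iff1 inf_commute)
  then show "greatest_in Q (f x)"
    using fx unfolding greatest_in_def by blast
qed

text \<open>If \<open>f\<close> takes a nontrivial value at the greatest element \<open>a\<close> of \<open>P\<close>, namely the greatest element
  \<open>b\<close> of \<open>Q\<close>, then \<open>f b \<le> a < top\<close>, so the value at \<open>b\<close> is nontrivial as well and must be \<open>a\<close>.\<close>

lemma swap_if_nontrivial_left:
  assumes f: "weak_complementation f" and x: "x \<in> P" "f x \<noteq> top"
  shows "greatest_in P x \<and> greatest_in Q (f x) \<and> f = swap_wc x (f x)"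
proof -
  interpret flip: horizontal_split Q P
    by (rule flip)
  note great = nontrivial_value[OF f x]
  have fx: "f x \<in> Q"
    using great(2) unfolding greatest_in_def by blast
  have "f (f x) \<le> x"
    using f unfolding weak_complementation_def by blast
  then have ffx: "f (f x) \<noteq> top"
    using not_bounds(2)[OF x(1)] by (auto simp: top_unique)
  have "greatest_in P (f (f x))"
    by (rule flip.nontrivial_value(2)[OF f fx ffx])
  then have ffx_eq: "f (f x) = x"
    using great(1) by (rule greatest_in_unique)
  have "f z = top" if z: "z \<noteq> top" "z \<noteq> x" "z \<noteq> f x" for z
  proof (rule ccontr)
    assume "f z \<noteq> top"
    then have "z \<in> P \<or> z \<in> Q"
      using proper_cases[of z] z weak_complementation_bot[OF f] by auto
    then show False
      using nontrivial_value(1)[OF f _ \<open>f z \<noteq> top\<close>] flip.nontrivial_value(1)[OF f _ \<open>f z \<noteq> top\<close>]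
        great z greatest_in_unique by blast
  qed
  then have "f = swap_wc x (f x)"
    unfolding swap_wc_def using weak_complementation_top[OF f] ffx_eq
    by auto
  with great show ?thesis
    by blast
qed

lemma nontrivial_imp_swap:
  assumes f: "weak_complementation f" and "f \<noteq> trivial_wc"
  shows "\<exists>a b. greatest_in P a \<and> greatest_in Q b \<and> f = swap_wc a b"
proof -
  interpret flip: horizontal_split Q P
    by (rule flip)
  obtain x where x: "x \<noteq> top" "f x \<noteq> top"
    using assms(2) weak_complementation_top[OF f] unfolding trivial_wc_def fun_eq_iff by metis
  then consider "x \<in> P" | "x \<in> Q"
    using proper_cases[of x] weak_complementation_bot[OF f] by auto
  then show ?thesis
  proof cases
    case 1
    then show ?thesis
      using swap_if_nontrivial_left[OF f _ x(2)] by blast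
  next
    case 2
    then have *: "greatest_in Q x" "greatest_in P (f x)" "f = swap_wc x (f x)"
      using flip.swap_if_nontrivial_left[OF f _ x(2)] by auto
    then have "x \<noteq> f x"
      using incomparable[of "f x" x] unfolding greatest_in_def by auto
    then have "swap_wc x (f x) = swap_wc (f x) x"
      unfolding swap_wc_def by auto
    with * show ?thesis
      by metis
  qed
qed

text \<open>Every join-dense \<open>J\<close> contains, below \<open>a\<close> and not below \<open>x\<close>, an element of \<open>P\<close> as soon as \<open>x\<close> is not
  above \<open>a\<close>, and likewise for \<open>b\<close> and \<open>Q\<close>. If both happen, the join of \<^term>\<open>J - {..x}\<close> is \<open>top\<close>. Besides
  the trivial case \<open>x = top\<close>, this leaves \<open>x = a\<close> and \<open>x = b\<close>. Then \<^term>\<open>J - {..x}\<close> lies in the other part,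
  because \<open>top \<notin> J\<close>, and loses only \<open>bot\<close> from the members of \<open>J\<close> below the greatest element of that part,
  so its join is that element.\<close>

lemma swap_represented_by:
  assumes a: "greatest_in P a" and b: "greatest_in Q b"
    and J: "join_dense J" "top \<notin> J"
  shows "represented_by (swap_wc a b) J"
proof -
  have ab: "a \<in> P" "b \<in> Q" and le: "\<And>x. x \<in> P \<Longrightarrow> x \<le> a" "\<And>x. x \<in> Q \<Longrightarrow> x \<le> b"
    using a b unfolding greatest_in_def by auto
  have dense: "\<And>x u. \<not> x \<le> u \<Longrightarrow> \<exists>j\<in>J. j \<le> x \<and> \<not> j \<le> u"
    using J(1) unfolding join_dense_iff_separating by blast
  have below: "j = bot \<or> j \<le> a \<or> j \<le> b" if "j \<in> J" for j
    using proper_cases[of j] le J(2) that by auto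
  have lub: "isLub UNIV (J - {..c}) d"
    if cd: "inf c d = bot" and J_cd: "\<And>j. j \<in> J \<Longrightarrow> j = bot \<or> j \<le> c \<or> j \<le> d" for c d
    unfolding isLub_UNIV_iff
  proof (intro allI iffI)
    fix u
    assume "d \<le> u"
    then show "\<forall>j\<in>J - {..c}. j \<le> u"
      using J_cd by (metis DiffE atMost_iff bot_least order_trans)
  next
    fix u
    assume u: "\<forall>j\<in>J - {..c}. j \<le> u"
    show "d \<le> u"
    proof (rule ccontr)
      assume "\<not> d \<le> u"
      then obtain j where j: "j \<in> J" "j \<le> d" "\<not> j \<le> u"
        using dense by blast
      then have "j \<le> c"
        using u by auto
      with j(2) have "j \<le> inf c d"
        by simp
      with j(3) show False
        unfolding cd by (simp add: bot_unique)
    qed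
  qed
  have "isLub UNIV (J - {..x}) (swap_wc a b x)" for x
  proof -
    consider "x = top" | "x = a" | "x = b" | "x \<noteq> top" "x \<noteq> a" "x \<noteq> b"
      by blast
    then show ?thesis
    proof cases
      case 1
      then show ?thesis
        unfolding isLub_UNIV_iff swap_wc_def by auto
    next
      case 2
      moreover have "swap_wc a b a = b"
        using not_bounds(2)[OF ab(1)] unfolding swap_wc_def by simp
      ultimately show ?thesis
        using lub[of a b] inf_across[OF ab] below by auto
    next
      case 3
      moreover have "swap_wc a b b = a"
        using not_bounds(4)[OF ab(2)] incomparable[OF ab] unfolding swap_wc_def by auto
      ultimately show ?thesis
        using lub[of b a] inf_across[OF ab] below by (auto simp: inf_commute)
    next
      case 4
      have "\<not> a \<le> x" "\<not> b \<le> x"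
        using proper_cases[of x] 4 ab le incomparable[of a x] incomparable[of x b]
          not_bounds(1,3) by (auto simp: bot_unique intro: antisym)
      then obtain p q where p: "p \<in> J" "p \<le> a" "\<not> p \<le> x" and q: "q \<in> J" "q \<le> b" "\<not> q \<le> x"
        using dense by metis
      then have "p \<noteq> bot" "q \<noteq> bot"
        by auto
      then have "p \<in> P" "q \<in> Q"
        using left_of_le horizontal_split.left_of_le[OF flip] p q ab by blast+
      then have "sup p q = top"
        by (rule sup_across)
      have "u = top" if "\<forall>j\<in>J - {..x}. j \<le> u" for u
      proof -
        have "sup p q \<le> u"
          using that p q by auto
        then show ?thesis
          unfolding \<open>sup p q = top\<close> by (simp add: top_unique)
      qed
      then have "isLub UNIV (J - {..x}) top"
        unfolding isLub_UNIV_iff by (auto simp: top_unique)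
      with 4 show ?thesis
        unfolding swap_wc_def by simp
    qed
  qed
  with J(1) show ?thesis
    unfolding represented_by_def by blast
qed

lemma below_greatest_join_dense:
  assumes "greatest_in P a" "greatest_in Q b"
  shows "join_dense ({..a} \<union> {..b})" and "top \<notin> {..a} \<union> {..b}"
proof -
  have ab: "a \<in> P" "b \<in> Q" and le: "\<And>x. x \<in> P \<Longrightarrow> x \<le> a" "\<And>x. x \<in> Q \<Longrightarrow> x \<le> b"
    using assms unfolding greatest_in_def by auto
  show "top \<notin> {..a} \<union> {..b}"
    using not_bounds ab by (auto simp: top_unique)
  show "join_dense ({..a} \<union> {..b})"
    unfolding join_dense_iff_separating
  proof (intro allI impI)
    fix x u :: 'a
    assume nle: "\<not> x \<le> u"
    show "\<exists>j\<in>{..a} \<union> {..b}. j \<le> x \<and> \<not> j \<le> u"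
    proof (cases "x = top")
      case True
      have "\<not> (a \<le> u \<and> b \<le> u)"
        using sup_across[OF ab] nle True by (metis le_sup_iff)
      then show ?thesis
        using True by auto
    next
      case False
      then show ?thesis
        using nle proper_cases[of x] le by auto
    qed
  qed
qed

lemma top_not_Sji: "top \<notin> (Sji :: 'a set)"
proof
  assume "top \<in> (Sji :: 'a set)"
  then obtain m :: 'a where m: "m < top" "\<And>x. x < top \<Longrightarrow> x \<le> m"
    unfolding Sji_def strictly_join_irreducible_def by blast
  obtain p q where pq: "p \<in> P" "q \<in> Q"
    using nonempty by blast
  then have "p \<le> m" "q \<le> m"
    using m(2) not_bounds by (auto simp: less_top)
  then have "sup p q \<le> m"
    by simp
  with m(1) sup_across[OF pq] show False
    by (simp add: top_unique)
qed

lemma swap_less_trivial: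
  assumes a: "a \<in> P" and b: "b \<in> Q"
  shows "swap_wc a b < trivial_wc"
proof -
  have "swap_wc a b a = b" "trivial_wc a = top"
    using not_bounds a unfolding swap_wc_def trivial_wc_def by auto
  then have "\<not> trivial_wc a \<le> swap_wc a b a"
    using not_bounds(4)[OF b] by (simp add: top_unique)
  moreover have "swap_wc a b x \<le> trivial_wc x" for x
    unfolding swap_wc_def trivial_wc_def by simp
  ultimately show ?thesis
    unfolding less_fun_def le_fun_def by blast
qed

lemma swap_wc_characterization:
  assumes a: "greatest_in P a" and b: "greatest_in Q b"
  shows "represented_by (swap_wc a b) ({..a} \<union> {..b})"
    and "swap_wc a b < trivial_wc"
    and "{f. weak_complementation f} = {trivial_wc, swap_wc a b}"
proof -
  show rep: "represented_by (swap_wc a b) ({..a} \<union> {..b})"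
    using swap_represented_by[OF a b] below_greatest_join_dense[OF a b] by blast
  show "swap_wc a b < trivial_wc"
    using swap_less_trivial a b unfolding greatest_in_def by blast
  have "f = trivial_wc \<or> f = swap_wc a b" if "weak_complementation f" for f :: "'a \<Rightarrow> 'a"
    using nontrivial_imp_swap[OF that] a b greatest_in_unique by metis
  then show "{f. weak_complementation f} = {trivial_wc, swap_wc a b}"
    using represented_by_imp_weak_complementation[OF rep]
      represented_by_imp_weak_complementation[OF trivial_wc_represented_by] by blast
qed

end

section \<open>Horizontal sums\<close>

lemma exists_proper_element:
  assumes "infinite (UNIV :: 'a::bounded_lattice set) \<or> card (UNIV :: 'a set) > 2"
  shows "\<exists>x::'a. x \<noteq> bot \<and> x \<noteq> top"
proof (rule ccontr)
  assume "\<not> ?thesis"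
  then have U: "(UNIV :: 'a set) = {bot, top}"
    by auto
  have "finite {bot, top :: 'a}" "card {bot, top :: 'a} \<le> 2"
    by (simp_all add: card_insert_if)
  with assms show False
    unfolding U by auto
qed

lemma hsum_horizontal_split:
  assumes "\<exists>x::'a::nontrivial_bounded_lattice. x \<noteq> bot \<and> x \<noteq> top"
    and "\<exists>y::'b::nontrivial_bounded_lattice. y \<noteq> bot \<and> y \<noteq> top"
  shows "horizontal_split (hleft ` (- {bot, top}) :: ('a, 'b) hsum set) (hright ` (- {bot, top}))"
proof
  show "hleft ` (- {bot, top}) \<union> hright ` (- {bot, top}) = - {bot, top :: ('a, 'b) hsum}"
  proof -
    have "hleft ` (- {bot, top}) = range hleft - {bot, top :: ('a, 'b) hsum}"
      unfolding Compl_eq_Diff_UNIV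
      by (subst image_set_diff) (simp_all add: inj_def hleft_embedding)
    moreover have "hright ` (- {bot, top}) = range hright - {bot, top :: ('a, 'b) hsum}"
      unfolding Compl_eq_Diff_UNIV
      by (subst image_set_diff) (simp_all add: inj_def hright_embedding)
    ultimately show ?thesis
      by (simp only: Un_Diff[symmetric] hsum_cover Compl_eq_Diff_UNIV)
  qed
  show "hleft ` (- {bot, top}) \<noteq> ({} :: ('a, 'b) hsum set)"
    "hright ` (- {bot, top}) \<noteq> ({} :: ('a, 'b) hsum set)"
    using assms by auto
next
  fix u v :: "('a, 'b) hsum"
  assume "u \<in> hleft ` (- {bot, top})" "v \<in> hright ` (- {bot, top})"
  then obtain x y where *: "u = hleft x" "v = hright y"
      "x \<noteq> bot" "x \<noteq> top" "y \<noteq> bot" "y \<noteq> top"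
    by auto
  show "inf u v = bot"
    unfolding *(1,2) using *(3-) by transfer simp
  show "sup u v = top"
    unfolding *(1,2) using *(3-) by transfer simp
qed

text \<open>The existence of a proper element guarantees that the predecessor of \<open>top\<close> is not \<open>bot\<close>.\<close>

lemma top_sji_iff_greatest_proper:
  assumes "\<exists>x::'a::bounded_lattice. x \<noteq> bot \<and> x \<noteq> top"
  shows "strictly_join_irreducible (top :: 'a) \<longleftrightarrow> (\<exists>m::'a. greatest_in (- {bot, top}) m)"
    and "strictly_join_irreducible (top :: 'a) \<Longrightarrow> greatest_in (- {bot, top}) (predecessor (top :: 'a))"
proof -
  show pred: "greatest_in (- {bot, top}) (predecessor (top :: 'a))"
    if "strictly_join_irreducible (top :: 'a)"
    using predecessor_greatest[OF that] assms
    unfolding greatest_in_def by (auto simp: less_top bot_unique)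
  have "strictly_join_irreducible (top :: 'a)" if "greatest_in (- {bot, top}) m" for m :: 'a
    unfolding strictly_join_irreducible_def
  proof (intro exI conjI allI impI)
    show "m < top"
      using that unfolding greatest_in_def by (simp add: less_top)
    show "x \<le> m" if "x < top" for x
      using that \<open>greatest_in (- {bot, top}) m\<close> unfolding greatest_in_def
      by (cases "x = bot") (auto simp: less_top)
  qed
  with pred show "strictly_join_irreducible (top :: 'a) \<longleftrightarrow> (\<exists>m::'a. greatest_in (- {bot, top}) m)"
    by blast
qed

lemma greatest_in_hleft: "greatest_in (hleft ` S) (hleft a) \<longleftrightarrow> greatest_in S a"
  unfolding greatest_in_def by (auto simp: hleft_embedding)

lemma greatest_in_hright: "greatest_in (hright ` S) (hright b) \<longleftrightarrow> greatest_in S b"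
  unfolding greatest_in_def by (auto simp: hright_embedding)

theorem theorem6p5:
  assumes "infinite (UNIV :: 'a::nontrivial_bounded_lattice set) \<or> card (UNIV :: 'a set) > 2"
    and "infinite (UNIV :: 'b::nontrivial_bounded_lattice set) \<or> card (UNIV :: 'b set) > 2"
  shows "((\<exists>f :: ('a, 'b) hsum \<Rightarrow> ('a, 'b) hsum. weak_complementation f \<and> f \<noteq> trivial_wc)
            \<longleftrightarrow> strictly_join_irreducible (top :: 'a) \<and> strictly_join_irreducible (top :: 'b))
     \<and> (strictly_join_irreducible (top :: 'a) \<and> strictly_join_irreducible (top :: 'b) \<longrightarrow>
         (let a = hleft (predecessor (top :: 'a)) :: ('a, 'b) hsum;
              b = hright (predecessor (top :: 'b)) :: ('a, 'b) hsum
          in {f. weak_complementation f} = {trivial_wc, swap_wc a b}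
             \<and> card {f :: ('a, 'b) hsum \<Rightarrow> ('a, 'b) hsum. weak_complementation f} = 2
             \<and> representable (trivial_wc :: ('a, 'b) hsum \<Rightarrow> ('a, 'b) hsum)
             \<and> representable (swap_wc a b)
             \<and> represented_by (swap_wc a b) ({..a} \<union> {..b})
             \<and> swap_wc a b < trivial_wc
             \<and> (is_complete TYPE(('a, 'b) hsum) \<and> dually_algebraic TYPE(('a, 'b) hsum)
                  \<longrightarrow> represented_by (swap_wc a b) Sji)))"
proof -
  note ex = exists_proper_element[OF assms(1)] exists_proper_element[OF assms(2)]
  let ?P = "hleft ` (- {bot, top}) :: ('a, 'b) hsum set"
  let ?Q = "hright ` (- {bot, top}) :: ('a, 'b) hsum set"
  interpret horizontal_split ?P ?Q
    using ex by (rule hsum_horizontal_split)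
  define a b where "a = (hleft (predecessor top) :: ('a, 'b) hsum)"
    and "b = (hright (predecessor top) :: ('a, 'b) hsum)"
  have great: "greatest_in ?P a" "greatest_in ?Q b"
    if "strictly_join_irreducible (top :: 'a)" "strictly_join_irreducible (top :: 'b)"
    using that top_sji_iff_greatest_proper(2)[OF ex(1)] top_sji_iff_greatest_proper(2)[OF ex(2)]
    unfolding a_def b_def greatest_in_hleft greatest_in_hright by blast+
  have sji: "strictly_join_irreducible (top :: 'a) \<and> strictly_join_irreducible (top :: 'b)"
    if "weak_complementation f" "f \<noteq> trivial_wc" for f :: "('a, 'b) hsum \<Rightarrow> ('a, 'b) hsum"
  proof -
    obtain c d where cd: "greatest_in ?P c" "greatest_in ?Q d"
      using nontrivial_imp_swap[OF \<open>weak_complementation f\<close> \<open>f \<noteq> trivial_wc\<close>] by blast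
    then obtain x y where "greatest_in ?P (hleft x)" "greatest_in ?Q (hright y)"
      unfolding greatest_in_def by blast
    then show ?thesis
      using top_sji_iff_greatest_proper(1)[OF ex(1)] top_sji_iff_greatest_proper(1)[OF ex(2)]
      unfolding greatest_in_hleft greatest_in_hright by blast
  qed
  have main: "{f. weak_complementation f} = {trivial_wc, swap_wc a b}
        \<and> card {f :: ('a, 'b) hsum \<Rightarrow> ('a, 'b) hsum. weak_complementation f} = 2
        \<and> representable (trivial_wc :: ('a, 'b) hsum \<Rightarrow> ('a, 'b) hsum)
        \<and> representable (swap_wc a b)
        \<and> represented_by (swap_wc a b) ({..a} \<union> {..b})
        \<and> swap_wc a b < trivial_wc
        \<and> (is_complete TYPE(('a, 'b) hsum) \<and> dually_algebraic TYPE(('a, 'b) hsum)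
              \<longrightarrow> represented_by (swap_wc a b) Sji)"
    if "strictly_join_irreducible (top :: 'a) \<and> strictly_join_irreducible (top :: 'b)"
  proof -
    note g = great[OF conjunct1[OF that] conjunct2[OF that]]
    note char = swap_wc_characterization[OF g]
    have "trivial_wc \<noteq> swap_wc a b"
      using char(2) by auto
    then have "card {f :: ('a, 'b) hsum \<Rightarrow> ('a, 'b) hsum. weak_complementation f} = 2"
      unfolding char(3) by simp
    moreover have "represented_by (swap_wc a b) Sji" if "dually_algebraic TYPE(('a, 'b) hsum)"
      using swap_represented_by[OF g] dually_algebraic_Sji_join_dense[OF that] top_not_Sji by blast
    ultimately show ?thesis
      using char(2,3)
      by (intro conjI impI) (use char(1) trivial_wc_represented_by representable_def in auto)
  qed
  have swap: "\<exists>f :: ('a, 'b) hsum \<Rightarrow> ('a, 'b) hsum. weak_complementation f \<and> f \<noteq> trivial_wc"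
    if "strictly_join_irreducible (top :: 'a) \<and> strictly_join_irreducible (top :: 'b)"
  proof (intro exI conjI)
    note char = swap_wc_characterization[OF great[OF conjunct1[OF that] conjunct2[OF that]]]
    show "weak_complementation (swap_wc a b)"
      by (rule represented_by_imp_weak_complementation[OF char(1)])
    show "swap_wc a b \<noteq> trivial_wc"
      using char(2) by auto
  qed
  show ?thesis
    unfolding Let_def a_def[symmetric] b_def[symmetric]
  proof (rule conjI)
    show "(\<exists>f :: ('a, 'b) hsum \<Rightarrow> ('a, 'b) hsum. weak_complementation f \<and> f \<noteq> trivial_wc)
        \<longleftrightarrow> strictly_join_irreducible (top :: 'a) \<and> strictly_join_irreducible (top :: 'b)"
      using sji swap by iprover
  qed (rule impI, rule main)
qed

end
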